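(* Suppose $1\le p<\infty$. Let $\{\phi_t:t\ge0\}$ be a semigroup of analytic self-maps of the upper half-plane $\mathbb{U}$ such that every composition operator $T_t(f)=f\circ\phi_t$, $t\ge0$, is bounded on $H^p(\mathbb{U})$. Then $\{T_t\}$ is uniformly continuous on $H^p(\mathbb{U})$ if and only if $\{\phi_t\}$ is trivial, i.e. $\phi_t(z)=z$ for all $t\ge 0$ and $z\in\mathbb{U}$. In other words, the only uniformly continuous semigroup $\{T_t\}$ on $H^p(\mathbb{U})$ is the one induced by the trivial semigroup.
   Context: $\mathbb{U}=\{z\in\mathbb{C}:\operatorname{Im} z>0\}$. $H^p(\mathbb{U})$ is the space of analytic $f:\mathbb{U}\to\mathbb{C}$ with $\|f\|_p=\sup_{y>0}\left(\int_{-\infty}^{\infty}|f(x+iy)|^p\,dx\right)^{1/p}<\infty$, a Banach space for $p\ge1$. A semigroup of analytic self-maps of $\mathbb{U}$ is a family $\{\phi_t:t\ge0\}$ of analytic maps $\phi_t:\mathbb{U}\to\mathbb{U}$ such that $\phi_0(z)\equiv z$, $\phi_{t+s}=\phi_t\circ\phi_s$ for $t,s\ge0$, and $(t,z)\mapsto\phi_t(z)$ is jointly continuous on $[0,\infty)\times\mathbb{U}$. The operator semigroup $\{T_t\}$ is uniformly continuous if $\|T_t-I\|\to0$ in the operator norm of $H^p(\mathbb{U})$ as $t\to0^+$. *)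

theory Defs
  imports "HOL-Analysis.Analysis"
begin

definition upper_half_plane :: "complex set" where
  "upper_half_plane = {z. 0 < Im z}"

definition Hp_mean :: "real \<Rightarrow> (complex \<Rightarrow> complex) \<Rightarrow> real \<Rightarrow> real" where
  "Hp_mean p f y = (LINT x|lborel. cmod (f (Complex x y)) powr p) powr (1 / p)"

text \<open>
  An element of the Hardy space is represented by any total function with the right restriction
  to the half-plane; values outside are irrelevant. The integrability condition is needed because
  the Bochner integral of a non-integrable function is \<open>0\<close> instead of \<open>\<infinity>\<close>. Together with
  boundedness of the means it says that the supremum defining the norm is finite.
\<close>

definition Hp :: "real \<Rightarrow> (complex \<Rightarrow> complex) set" where
  "Hp p = {f. f holomorphic_on upper_half_plane \<and>
     (\<forall>y>0. integrable lborel (\<lambda>x. cmod (f (Complex x y)) powr p)) \<and>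
     bdd_above (Hp_mean p f ` {0<..})}"

text \<open>Meaningful only on \<open>Hp p\<close>, where the real supremum is that of a bounded set.\<close>

definition Hp_norm :: "real \<Rightarrow> (complex \<Rightarrow> complex) \<Rightarrow> real" where
  "Hp_norm p f = (SUP y\<in>{0<..}. Hp_mean p f y)"

text \<open>
  Linearity is not part of this definition; it is only applied to composition operators, which
  are linear.
\<close>

definition bounded_on_Hp ::
  "real \<Rightarrow> ((complex \<Rightarrow> complex) \<Rightarrow> complex \<Rightarrow> complex) \<Rightarrow> bool" where
  "bounded_on_Hp p S \<longleftrightarrow>
     (\<forall>f\<in>Hp p. S f \<in> Hp p) \<and> (\<exists>C. \<forall>f\<in>Hp p. Hp_norm p (S f) \<le> C * Hp_norm p f)"

text \<open>Operator norm; meaningful only for linear operators that are bounded on \<open>Hp p\<close>.\<close>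

definition Hp_opnorm ::
  "real \<Rightarrow> ((complex \<Rightarrow> complex) \<Rightarrow> complex \<Rightarrow> complex) \<Rightarrow> real" where
  "Hp_opnorm p S = (SUP f\<in>{f \<in> Hp p. Hp_norm p f \<le> 1}. Hp_norm p (S f))"

definition uniformly_continuous_semigroup_on_Hp ::
  "real \<Rightarrow> (real \<Rightarrow> (complex \<Rightarrow> complex) \<Rightarrow> complex \<Rightarrow> complex) \<Rightarrow> bool" where
  "uniformly_continuous_semigroup_on_Hp p T \<longleftrightarrow>
     ((\<lambda>t. Hp_opnorm p (\<lambda>f z. T t f z - f z)) \<longlongrightarrow> 0) (at_right 0)"

definition analytic_semigroup :: "(real \<Rightarrow> complex \<Rightarrow> complex) \<Rightarrow> bool" where
  "analytic_semigroup \<phi> \<longleftrightarrow>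
     (\<forall>t\<ge>0. \<phi> t holomorphic_on upper_half_plane \<and> \<phi> t ` upper_half_plane \<subseteq> upper_half_plane) \<and>
     (\<forall>z\<in>upper_half_plane. \<phi> 0 z = z) \<and>
     (\<forall>t\<ge>0. \<forall>s\<ge>0. \<forall>z\<in>upper_half_plane. \<phi> (t + s) z = \<phi> t (\<phi> s z)) \<and>
     continuous_on ({0..} \<times> upper_half_plane) (\<lambda>(t, z). \<phi> t z)"

definition composition_operator ::
  "(complex \<Rightarrow> complex) \<Rightarrow> (complex \<Rightarrow> complex) \<Rightarrow> complex \<Rightarrow> complex" where
  "composition_operator \<psi> f = f \<circ> \<psi>"

end

theory Submission
  imports Defs "HOL-Complex_Analysis.Complex_Analysis"
begin

text \<open>
  Triviality of the semigroup clearly makes every \<open>T\<^sub>t - I\<close> vanish. For the converse, fix \<open>t\<close> so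
  small that \<open>T\<^sub>t - I\<close> has operator norm at most \<open>1/192\<close>. Testing this operator on the kernel
  \<open>w \<mapsto> c / (w - cnj z)\<^sup>2\<close>, normalized in \<open>H\<^sup>p\<close> (\<open>squared_kernel_in_unit_ball\<close>), and evaluating at
  \<open>z\<close> shows that the kernel has nearly the same value at \<open>\<phi>\<^sub>t z\<close> as at \<open>z\<close>, relative to its size
  there. Because the kernel is concentrated at scale \<open>Im z\<close> around \<open>z\<close>, the point \<open>\<phi>\<^sub>t z\<close> cannot be
  far away on that scale: \<open>\<bar>\<phi>\<^sub>t z - z\<bar> \<le> 5 Im z\<close> (\<open>displacement_le_Im\<close>). This holds with one
  constant for all \<open>z\<close>, so the holomorphic function \<open>\<phi>\<^sub>t z - z\<close> has boundary value \<open>0\<close> on the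
  whole real axis and hence vanishes identically (\<open>eq_0_if_norm_le_Im\<close>). Thus \<open>\<phi>\<^sub>t\<close> is the identity
  for all small \<open>t\<close>, and by the semigroup law for all \<open>t\<close>.

  The analytic ingredient is the bound \<open>\<bar>f z\<bar> \<le> 6 \<parallel>f\<parallel>\<^sub>p (Im z)\<^bsup>-1/p\<^esup>\<close> for point evaluation
  (\<open>point_evaluation_bound\<close>). Instead of averaging over discs, its proof uses a primitive of \<open>f\<close>:
  horizontal increments of the primitive are integrals of \<open>f\<close> over line segments, so they are
  uniformly bounded, and Cauchy's inequality for these increments controls the variation of \<open>f\<close>.
\<close>

section \<open>Holomorphic functions vanishing at the real axis\<close>

lemma open_upper_half_plane: "open upper_half_plane"
  and convex_upper_half_plane: "convex upper_half_plane"
  unfolding upper_half_plane_def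
  by (auto simp: open_halfspace_Im_gt convex_halfspace_Im_gt)

text \<open>
  The bound lets \<open>h\<close> be continued by \<open>0\<close> across the real axis: the result is continuous, hence
  entire, and it vanishes on a half-plane.
\<close>

lemma eq_0_if_norm_le_Im:
  assumes holo: "h holomorphic_on upper_half_plane"
    and bound: "\<And>z. z \<in> upper_half_plane \<Longrightarrow> cmod (h z) \<le> K * Im z"
    and z: "z \<in> upper_half_plane"
  shows "h z = 0"
proof -
  define H where "H = (\<lambda>w. if 0 < Im w then h w else 0)"
  have K: "cmod (H w) \<le> \<bar>K\<bar> * \<bar>Im w\<bar>" for w
    using bound[of w] by (auto simp: H_def upper_half_plane_def abs_mult[symmetric])
  have upper: "H holomorphic_on {w. 0 < Im w}"
    by (rule holomorphic_transform[OF holo[unfolded upper_half_plane_def]]) (simp add: H_def)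
  have lower: "H holomorphic_on {w. Im w < 0}"
    by (rule holomorphic_transform[of "\<lambda>_. 0"]) (auto simp: H_def)
  have "isCont H w" for w
  proof (cases "Im w" "0::real" rule: linorder_cases)
    case less
    then show ?thesis
      using holomorphic_on_imp_continuous_on[OF lower]
      by (simp add: continuous_on_eq_continuous_at open_halfspace_Im_lt)
  next
    case greater
    then show ?thesis
      using holomorphic_on_imp_continuous_on[OF upper]
      by (simp add: continuous_on_eq_continuous_at open_halfspace_Im_gt)
  next
    case equal
    have "((\<lambda>x. \<bar>K\<bar> * \<bar>Im x\<bar>) \<longlongrightarrow> \<bar>K\<bar> * \<bar>Im w\<bar>) (at w)"
      by (intro tendsto_intros)
    then have "((\<lambda>x. \<bar>K\<bar> * \<bar>Im x\<bar>) \<longlongrightarrow> 0) (at w)"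
      using equal by simp
    then have "(H \<longlongrightarrow> 0) (at w)"
      by (rule Lim_null_comparison[rotated]) (simp add: K)
    then show ?thesis
      using equal by (simp add: isCont_def H_def)
  qed
  then have cont: "continuous_on UNIV H"
    by (simp add: continuous_at_imp_continuous_on)
  have entire: "H holomorphic_on UNIV"
    by (rule holomorphic_on_paste_across_line[where d = \<i> and k = 0])
      (use upper lower cont in \<open>auto simp: inner_complex_def\<close>)
  have "H z = 0"
  proof (rule analytic_continuation_open[of "{w. Im w < 0}" UNIV H "\<lambda>_. 0"])
    show "{w. Im w < 0} \<noteq> {}"
      by (auto intro!: exI[of _ "- \<i>"])
  qed (use entire in \<open>auto simp: H_def open_halfspace_Im_lt\<close>)
  then show ?thesis
    using z by (simp add: H_def upper_half_plane_def)
qed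

section \<open>Point evaluations on the Hardy space\<close>

text \<open>
  This replaces Hoelder's inequality when passing from \<open>\<bar>f\<bar>\<^sup>p\<close> to \<open>\<bar>f\<bar>\<close>: above the threshold \<open>M\<close>
  the factor \<open>a\<^bsup>1-p\<^esup>\<close> is at most \<open>M\<^bsup>1-p\<^esup>\<close>.
\<close>

lemma le_threshold_plus_powr:
  fixes a M p :: real
  assumes "0 \<le> a" "0 < M" "1 \<le> p"
  shows "a \<le> M + M powr (1 - p) * a powr p"
proof (cases "a \<le> M")
  case True
  then show ?thesis by (simp add: add_increasing2)
next
  case False
  then have "a = a powr (1 - p) * a powr p"
    using assms by (simp flip: powr_add)
  also have "\<dots> \<le> M powr (1 - p) * a powr p"
    using False assms by (intro mult_right_mono powr_mono2') auto
  finally show ?thesis using assms by simp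
qed

text \<open>
  The increment is the integral of \<open>f\<close> over a horizontal segment of length at most \<open>y\<close>; only the
  \<open>p\<close>-th power mass of \<open>f\<close> on that line enters. The height of the line is unrelated to \<open>y\<close>, which
  makes the bound uniform on the half-plane.
\<close>

lemma primitive_increment_bound:
  assumes p: "1 \<le> p" and \<eta>: "0 < \<eta>"
    and prim: "\<And>w. w \<in> upper_half_plane \<Longrightarrow> (\<Phi> has_field_derivative f w) (at w)"
    and int: "integrable lborel (\<lambda>x. cmod (f (Complex x (Im z))) powr p)"
    and mass: "(LINT x|lborel. cmod (f (Complex x (Im z))) powr p) \<le> \<eta> powr p"
    and z: "z \<in> upper_half_plane" and h: "0 \<le> h" "h \<le> y" and y: "0 < y"
  shows "cmod (\<Phi> (z + of_real h) - \<Phi> z) \<le> 2 * \<eta> * y powr (1 - 1/p)"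
proof -
  define v where "v = Im z"
  define x where "x = Re z"
  have v: "0 < v" using z by (simp add: v_def upper_half_plane_def)
  \<comment> \<open>This threshold makes the two contributions \<open>M * y\<close> and \<open>M\<^bsup>1-p\<^esup> * \<eta>\<^bsup>p\<^esup>\<close> equal.\<close>
  define M where "M = \<eta> * y powr (-1/p)"
  have M: "0 < M" using \<eta> y by (simp add: M_def)
  let ?P = "\<lambda>s. cmod (f (Complex s v)) powr p"
  have shift: "z + of_real h = Complex (x + h) v" "z = Complex x v"
    by (simp_all add: complex_eq_iff x_def v_def)
  have deriv: "((\<lambda>s. \<Phi> (Complex s v)) has_vector_derivative f (Complex s v)) (at s)" for s
  proof -
    have "((\<lambda>s. Complex s v) has_vector_derivative 1) (at s)"
      unfolding Complex_eq has_vector_derivative_def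
      by (auto intro!: derivative_eq_intros simp: scaleR_conv_of_real)
    moreover have "(\<Phi> has_field_derivative f (Complex s v)) (at (Complex s v))"
      using v by (intro prim) (simp add: upper_half_plane_def)
    ultimately show ?thesis
      using field_vector_diff_chain_at[of "\<lambda>s. Complex s v" 1 s \<Phi>] by (simp add: o_def)
  qed
  have FTC: "((\<lambda>s. f (Complex s v)) has_integral \<Phi> (Complex (x + h) v) - \<Phi> (Complex x v)) {x..x + h}"
    using h deriv by (intro fundamental_theorem_of_calculus) (auto intro: has_vector_derivative_at_within)
  have P: "?P integrable_on UNIV" "integral UNIV ?P \<le> \<eta> powr p"
    using integrable_on_lborel[OF int] integral_lborel[OF int] mass by (auto simp: v_def)
  have P': "?P integrable_on {x..x + h}"
    using integrable_on_subcbox[OF P(1), of x "x + h"] by simp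
  have "integral {x..x + h} ?P \<le> integral UNIV ?P"
    by (intro integral_subset_le P P') auto
  with P have P_le: "integral {x..x + h} ?P \<le> \<eta> powr p" by simp
  have "cmod (integral {x..x + h} (\<lambda>s. f (Complex s v)))
      \<le> integral {x..x + h} (\<lambda>s. M + M powr (1 - p) * ?P s)"
    using FTC P' M p
    by (intro Henstock_Kurzweil_Integration.integral_norm_bound_integral le_threshold_plus_powr
        integrable_add integrable_on_mult_right) (auto intro: has_integral_integrable)
  also have "\<dots> = M * h + M powr (1 - p) * integral {x..x + h} ?P"
    using P' h by (subst Henstock_Kurzweil_Integration.integral_add)
      (auto intro!: integrable_on_mult_right simp: mult.commute)
  also have "\<dots> \<le> M * y + M powr (1 - p) * \<eta> powr p"
    using M h P_le by (intro add_mono mult_left_mono) auto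
  also have "M * y = \<eta> * y powr (1 - 1/p)"
    using y by (simp add: M_def powr_diff powr_minus_divide)
  also have "M powr (1 - p) * \<eta> powr p = (\<eta> powr (1 - p) * \<eta> powr p) * y powr ((-1/p) * (1 - p))"
    using \<eta> y by (simp add: M_def powr_mult powr_powr)
  also have "\<eta> powr (1 - p) * \<eta> powr p = \<eta>"
    using \<eta> by (simp flip: powr_add)
  also have "(-1/p) * (1 - p) = 1 - 1/p"
    using p by (simp add: field_simps)
  finally show ?thesis
    using FTC shift by (simp add: integral_unique mult.assoc)
qed

text \<open>
  Let \<open>A\<close> bound the horizontal increments, by at most \<open>y = Im z\<close>, of a primitive \<open>\<Phi>\<close> of \<open>f\<close>. The
  mean of \<open>f\<close> over the segment from \<open>z\<close> to \<open>z + y\<close> is such an increment divided by \<open>y\<close>, so it is at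
  most \<open>A / y\<close>. On the segment, \<open>f (z + h) - f z\<close> is the derivative at \<open>z\<close> of the increment
  \<open>\<Phi> (w + h) - \<Phi> w\<close>, and Cauchy's inequality on the disc of radius \<open>y/2\<close> bounds it by \<open>2 A / y\<close>.
  Hence \<open>\<bar>f z\<bar> \<le> 3 A / y\<close>.
\<close>

lemma point_evaluation_bound:
  assumes p: "1 \<le> p" and \<eta>: "0 < \<eta>"
    and holo: "f holomorphic_on upper_half_plane"
    and int: "\<And>v. 0 < v \<Longrightarrow> integrable lborel (\<lambda>x. cmod (f (Complex x v)) powr p)"
    and mass: "\<And>v. 0 < v \<Longrightarrow> (LINT x|lborel. cmod (f (Complex x v)) powr p) \<le> \<eta> powr p"
    and z: "z \<in> upper_half_plane"
  shows "cmod (f z) \<le> 6 * \<eta> * Im z powr (-1/p)"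
proof -
  define y where "y = Im z"
  have y: "0 < y" using z by (simp add: y_def upper_half_plane_def)
  define A where "A = 2 * \<eta> * y powr (1 - 1/p)"
  obtain \<Phi> where \<Phi>: "\<And>w. w \<in> upper_half_plane \<Longrightarrow> (\<Phi> has_field_derivative f w) (at w)"
    using holomorphic_convex_primitive'[OF convex_upper_half_plane open_upper_half_plane holo]
    by (metis at_within_open open_upper_half_plane)
  have A: "cmod (\<Phi> (w + of_real h) - \<Phi> w) \<le> A"
    if "w \<in> upper_half_plane" "0 \<le> h" "h \<le> y" for w h
    unfolding A_def
    by (rule primitive_increment_bound[where f = f])
      (use that p \<eta> \<Phi> int mass y in \<open>auto simp: upper_half_plane_def\<close>)
  have variation: "cmod (f (z + of_real h) - f z) \<le> 2 * A / y" if h: "0 \<le> h" "h \<le> y" for h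
  proof -
    define \<Psi> where "\<Psi> = (\<lambda>w. \<Phi> (w + of_real h) - \<Phi> w)"
    have disc: "cball z (y/2) \<subseteq> upper_half_plane"
    proof
      fix w assume "w \<in> cball z (y/2)"
      then have "\<bar>Im (z - w)\<bar> \<le> y/2"
        using abs_Im_le_cmod[of "z - w"] by (simp add: dist_norm)
      then show "w \<in> upper_half_plane"
        using y unfolding upper_half_plane_def y_def by (simp add: abs_if split: if_splits)
    qed
    have deriv: "(\<Psi> has_field_derivative f (w + of_real h) - f w) (at w)"
      if "w \<in> upper_half_plane" for w
    proof -
      have "(\<Phi> has_field_derivative f (w + of_real h)) (at (w + of_real h))"
        using that by (intro \<Phi>) (simp add: upper_half_plane_def)
      then have "((\<lambda>w. \<Phi> (w + of_real h)) has_field_derivative f (w + of_real h)) (at w)"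
        by (simp add: DERIV_shift)
      then show ?thesis
        unfolding \<Psi>_def using \<Phi>[OF that] by (rule DERIV_diff)
    qed
    have holo: "\<Psi> holomorphic_on upper_half_plane"
      using deriv by (meson holomorphic_onI field_differentiable_at_within field_differentiable_def)
    have "cmod ((deriv ^^ 1) \<Psi> z) \<le> fact 1 * A / (y/2) ^ 1"
    proof (rule Cauchy_inequality)
      show "\<Psi> holomorphic_on ball z (y/2)"
        by (rule holomorphic_on_subset[OF holo]) (use disc ball_subset_cball in blast)
      show "continuous_on (cball z (y/2)) \<Psi>"
        by (rule continuous_on_subset[OF holomorphic_on_imp_continuous_on[OF holo] disc])
      show "0 < y/2" using y by simp
      fix w assume "cmod (z - w) = y/2"
      then have "w \<in> cball z (y/2)" by (simp add: dist_norm)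
      with disc have "w \<in> upper_half_plane" by blast
      then show "cmod (\<Psi> w) \<le> A"
        unfolding \<Psi>_def using A h by blast
    qed
    moreover have "deriv \<Psi> z = f (z + of_real h) - f z"
      using deriv[OF z] by (rule DERIV_imp_deriv)
    ultimately show ?thesis
      by (simp add: mult.commute)
  qed
  \<comment> \<open>The derivative of this function is the variation of \<open>f\<close> just bounded, and its increment
    over the segment is the difference between the increment of \<open>\<Phi>\<close> and \<open>y * f z\<close>.\<close>
  define G where "G = (\<lambda>w. \<Phi> w - w * f z)"
  have seg: "\<exists>h. 0 \<le> h \<and> h \<le> y \<and> w = z + of_real h" if "w \<in> closed_segment z (z + of_real y)" for w
  proof -
    from that obtain u where "0 \<le> u" "u \<le> 1" "w = z + of_real (u * y)"
      by (auto simp: in_segment algebra_simps scaleR_conv_of_real)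
    then show ?thesis
      using y by (intro exI[of _ "u * y"]) (auto simp: mult_left_le_one_le)
  qed
  have "cmod (G (z + of_real y) - G z) \<le> 2 * A / y * cmod (z + of_real y - z)"
  proof (rule field_differentiable_bound[where S = "closed_segment z (z + of_real y)"
        and f' = "\<lambda>w. f w - f z"])
    fix w assume w: "w \<in> closed_segment z (z + of_real y)"
    then obtain h where h: "0 \<le> h" "h \<le> y" "w = z + of_real h"
      using seg by blast
    have "w \<in> upper_half_plane"
      using z h by (simp add: upper_half_plane_def)
    then show "(G has_field_derivative f w - f z) (at w within closed_segment z (z + of_real y))"
      unfolding G_def
      by (auto intro!: derivative_eq_intros has_field_derivative_at_within[OF \<Phi>])
    show "cmod (f w - f z) \<le> 2 * A / y"
      using variation h by simp
  qed auto
  then have G: "cmod (G (z + of_real y) - G z) \<le> 2 * A"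
    using y by simp
  have "of_real y * f z = (\<Phi> (z + of_real y) - \<Phi> z) - (G (z + of_real y) - G z)"
    by (simp add: G_def algebra_simps)
  then have "cmod (of_real y * f z) \<le> cmod (\<Phi> (z + of_real y) - \<Phi> z) + cmod (G (z + of_real y) - G z)"
    by (metis norm_triangle_ineq4)
  then have "y * cmod (f z) \<le> 3 * A"
    using G A[OF z, of y] y by (simp add: norm_mult)
  also have "3 * A = y * (6 * \<eta> * y powr (-1/p))"
    using y by (simp add: A_def powr_diff powr_minus_divide)
  finally show ?thesis
    using y by (simp add: y_def)
qed

section \<open>Membership and norm estimates in the Hardy space\<close>

lemma has_bochner_integral_inverse_1_plus_square:
  "has_bochner_integral lborel (\<lambda>u::real. 1 / (1 + u\<^sup>2)) pi"
proof -
  have "set_integrable lborel (einterval (-\<infinity>) \<infinity>) (\<lambda>u::real. 1 / (1 + u\<^sup>2))"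
    "(LBINT u=-\<infinity>..\<infinity>. 1 / (1 + u\<^sup>2)) = pi/2 - (-(pi/2))"
    using tendsto_arctan_at_bot tendsto_arctan_at_top
    by (intro interval_integral_FTC_nonneg[where F = arctan];
        force intro!: derivative_eq_intros
          simp: ereal_tendsto_simps add_nonneg_eq_0_iff inverse_eq_divide)+
  then show ?thesis
    by (simp add: has_bochner_integral_iff interval_lebesgue_integral_def set_integrable_def
        set_lebesgue_integral_def)
qed

lemma borel_measurable_on_horizontal_line:
  assumes "f holomorphic_on upper_half_plane" "0 < v"
  shows "(\<lambda>x. f (Complex x v)) \<in> borel_measurable lborel"
proof -
  have "continuous_on UNIV (\<lambda>x. Complex x v)"
    unfolding Complex_eq by (intro continuous_intros)
  then have "continuous_on UNIV (\<lambda>x. f (Complex x v))"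
    by (rule continuous_on_compose2[OF holomorphic_on_imp_continuous_on[OF assms(1)]])
      (use assms(2) in \<open>auto simp: upper_half_plane_def\<close>)
  then show ?thesis
    by (simp add: borel_measurable_continuous_onI)
qed

lemma Hp_memI:
  assumes holo: "f holomorphic_on upper_half_plane" and p: "0 < p"
    and bound: "\<And>v. 0 < v \<Longrightarrow> integrable lborel (g v) \<and> (LINT x|lborel. g v x) \<le> A \<and>
      (\<forall>x. cmod (f (Complex x v)) powr p \<le> g v x)"
  shows "f \<in> Hp p" "Hp_norm p f \<le> A powr (1/p)"
proof -
  have int: "integrable lborel (\<lambda>x. cmod (f (Complex x v)) powr p)" if "0 < v" for v
  proof (rule Bochner_Integration.integrable_bound)
    show "integrable lborel (g v)" using bound that by blast
    show "(\<lambda>x. cmod (f (Complex x v)) powr p) \<in> borel_measurable lborel"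
      using borel_measurable_on_horizontal_line[OF holo that] by measurable
    show "AE x in lborel. norm (cmod (f (Complex x v)) powr p) \<le> norm (g v x)"
      using bound[OF that] by (intro AE_I2) (simp add: order_trans[OF _ abs_ge_self])
  qed
  have mean: "Hp_mean p f v \<le> A powr (1/p)" if "0 < v" for v
  proof -
    have "(LINT x|lborel. cmod (f (Complex x v)) powr p) \<le> (LINT x|lborel. g v x)"
      using int bound that by (intro integral_mono) auto
    with bound[OF that] p show ?thesis
      unfolding Hp_mean_def by (intro powr_mono2) auto
  qed
  then have "bdd_above (Hp_mean p f ` {0<..})"
    by (auto simp: bdd_above_def)
  with holo int show "f \<in> Hp p"
    by (simp add: Hp_def)
  show "Hp_norm p f \<le> A powr (1/p)"
    unfolding Hp_norm_def using mean by (intro cSUP_least) auto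
qed

lemma Hp_line_mass_le:
  assumes f: "f \<in> Hp p" and p: "0 < p" and le: "Hp_norm p f \<le> \<eta>" and v: "0 < v"
  shows "(LINT x|lborel. cmod (f (Complex x v)) powr p) \<le> \<eta> powr p"
proof -
  let ?I = "LINT x|lborel. cmod (f (Complex x v)) powr p"
  have "Hp_mean p f v \<le> Hp_norm p f"
    unfolding Hp_norm_def using f v by (intro cSUP_upper) (auto simp: Hp_def)
  with le have "?I powr (1/p) \<le> \<eta>"
    by (simp add: Hp_mean_def)
  then have "(?I powr (1/p)) powr p \<le> \<eta> powr p"
    using p by (intro powr_mono2) auto
  moreover have "0 \<le> ?I" by simp
  ultimately show ?thesis
    using p by (simp add: powr_powr)
qed

text \<open>
  The crude constant \<open>2\<^sup>p\<close> in place of Minkowski's inequality is enough to know that the operator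
  norm of a difference is a supremum over a bounded set.
\<close>

lemma Hp_diff:
  assumes f: "f \<in> Hp p" and g: "g \<in> Hp p" and p: "0 < p"
    and le: "Hp_norm p f \<le> a" "Hp_norm p g \<le> b"
  shows "(\<lambda>z. f z - g z) \<in> Hp p"
    "Hp_norm p (\<lambda>z. f z - g z) \<le> (2 powr p * (a powr p + b powr p)) powr (1/p)"
proof -
  have holo: "(\<lambda>z. f z - g z) holomorphic_on upper_half_plane"
    using f g by (auto simp: Hp_def intro!: holomorphic_intros)
  let ?G = "\<lambda>v x. 2 powr p * (cmod (f (Complex x v)) powr p + cmod (g (Complex x v)) powr p)"
  have pw: "cmod (u - w) powr p \<le> 2 powr p * (cmod u powr p + cmod w powr p)" for u w
  proof -
    have "cmod (u - w) \<le> 2 * max (cmod u) (cmod w)"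
      using norm_triangle_ineq4[of u w] by linarith
    then have "cmod (u - w) powr p \<le> (2 * max (cmod u) (cmod w)) powr p"
      using p by (intro powr_mono2) auto
    also have "\<dots> \<le> 2 powr p * (cmod u powr p + cmod w powr p)"
      by (auto simp: powr_mult max_def)
    finally show ?thesis .
  qed
  have bound: "integrable lborel (?G v) \<and> (LINT x|lborel. ?G v x) \<le> 2 powr p * (a powr p + b powr p) \<and>
      (\<forall>x. cmod (f (Complex x v) - g (Complex x v)) powr p \<le> ?G v x)" if v: "0 < v" for v
  proof (intro conjI allI pw)
    have int: "integrable lborel (\<lambda>x. cmod (f (Complex x v)) powr p)"
      "integrable lborel (\<lambda>x. cmod (g (Complex x v)) powr p)"
      using f g v by (auto simp: Hp_def)
    then show "integrable lborel (?G v)" by auto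
    show "(LINT x|lborel. ?G v x) \<le> 2 powr p * (a powr p + b powr p)"
      using int Hp_line_mass_le[OF f p le(1) v] Hp_line_mass_le[OF g p le(2) v]
      by (simp add: add_mono)
  qed
  show "(\<lambda>z. f z - g z) \<in> Hp p"
    "Hp_norm p (\<lambda>z. f z - g z) \<le> (2 powr p * (a powr p + b powr p)) powr (1/p)"
    using Hp_memI[OF holo p bound] by blast+
qed

section \<open>The test functions\<close>

text \<open>
  For \<open>p = 1\<close> the modulus on the real axis is the Poisson kernel of \<open>z\<close>. The square, rather than
  the Cauchy kernel, keeps the function \<open>p\<close>-integrable on lines also for \<open>p = 1\<close>.
\<close>

definition squared_kernel :: "real \<Rightarrow> complex \<Rightarrow> complex \<Rightarrow> complex" where
  "squared_kernel p z w =
     of_real (Im z powr (2 - 1/p) / pi powr (1/p)) / (w - cnj z)\<^sup>2"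

text \<open>
  Since \<open>p \<ge> 1\<close>, the \<open>p\<close>-th power of the modulus on any line is at most the Cauchy density with
  centre \<open>Re z\<close> and scale \<open>Im z\<close>, whose integral is \<open>1\<close>.
\<close>

lemma squared_kernel_in_unit_ball:
  assumes p: "1 \<le> p" and z: "z \<in> upper_half_plane"
  shows "squared_kernel p z \<in> Hp p" "Hp_norm p (squared_kernel p z) \<le> 1"
proof -
  define y where "y = Im z"
  define x0 where "x0 = Re z"
  have y: "0 < y" using z by (simp add: y_def upper_half_plane_def)
  define c where "c = y powr (2 - 1/p) / pi powr (1/p)"
  have c: "0 < c" using y by (simp add: c_def)
  have c_powr: "c powr p = y powr (2 * p) / (pi * y)"
  proof -
    have "c powr p = y powr ((2 - 1/p) * p) / pi powr (1/p * p)"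
      by (simp add: c_def powr_divide powr_powr)
    also have "(2 - 1/p) * p = 2 * p - 1"
      using p by (simp add: algebra_simps)
    finally show ?thesis
      using p y by (simp add: powr_diff)
  qed
  define G where "G = (\<lambda>x. 1 / (pi * y) * (1 / (1 + ((-x0/y) + (1/y) * x)\<^sup>2)))"
  have G: "has_bochner_integral lborel G 1"
  proof -
    have *: "integrable lborel (\<lambda>u::real. 1 / (1 + u\<^sup>2))" "(LINT u::real|lborel. 1 / (1 + u\<^sup>2)) = pi"
      using has_bochner_integral_inverse_1_plus_square by (auto simp: has_bochner_integral_iff)
    have "pi = \<bar>1/y\<bar> *\<^sub>R (LINT x|lborel. 1 / (1 + ((-x0/y) + (1/y) * x)\<^sup>2))"
      unfolding *(2)[symmetric] using y by (intro lborel_integral_real_affine) auto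
    then have "(LINT x|lborel. 1 / (1 + ((-x0/y) + (1/y) * x)\<^sup>2)) = pi * y"
      using y by (simp add: field_simps)
    moreover have "integrable lborel (\<lambda>x. 1 / (1 + ((-x0/y) + (1/y) * x)\<^sup>2))"
      using y by (intro lborel_integrable_real_affine *(1)) auto
    ultimately show ?thesis
      unfolding G_def has_bochner_integral_iff
      using y by (intro conjI integrable_mult_right) (simp_all only: integral_mult_right_zero, auto)
  qed
  have holo: "squared_kernel p z holomorphic_on upper_half_plane"
  proof -
    have "w - cnj z \<noteq> 0" if "w \<in> upper_half_plane" for w
      using that z by (auto simp: upper_half_plane_def complex_eq_iff)
    then show ?thesis
      unfolding squared_kernel_def by (intro holomorphic_intros) simp_all
  qed
  have pw: "cmod (squared_kernel p z (Complex x v)) powr p \<le> G x" if v: "0 < v" for x v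
  proof -
    define q where "q = 1 + ((-x0/y) + (1/y) * x)\<^sup>2"
    have q: "1 \<le> q" by (simp add: q_def)
    have "(cmod (Complex x v - cnj z))\<^sup>2 = (x - x0)\<^sup>2 + (v + y)\<^sup>2"
      by (simp add: cmod_power2 x0_def y_def)
    also have "\<dots> \<ge> (x - x0)\<^sup>2 + y\<^sup>2"
      using v y by (intro add_left_mono power_mono) auto
    also have "(x - x0)\<^sup>2 + y\<^sup>2 = y\<^sup>2 * q"
      using y by (simp add: q_def field_simps power2_eq_square)
    finally have D: "y\<^sup>2 * q \<le> (cmod (Complex x v - cnj z))\<^sup>2" .
    have "cmod (squared_kernel p z (Complex x v)) = c / (cmod (Complex x v - cnj z))\<^sup>2"
      using c unfolding squared_kernel_def y_def[symmetric] c_def[symmetric]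
      by (simp add: norm_divide norm_power)
    also have "\<dots> \<le> c / (y\<^sup>2 * q)"
      using D c y q by (intro frac_le) auto
    finally have "cmod (squared_kernel p z (Complex x v)) powr p \<le> (c / (y\<^sup>2 * q)) powr p"
      using p by (intro powr_mono2) auto
    also have "\<dots> = c powr p / (y powr (2 * p) * q powr p)"
      using y by (simp add: powr_divide powr_mult powr_powr flip: powr_numeral)
    also have "\<dots> = 1 / (pi * y) * (1 / q powr p)"
      using y by (simp add: c_powr)
    also have "\<dots> \<le> 1 / (pi * y) * (1 / q)"
      using q p y powr_mono[of 1 p q] by (intro mult_left_mono divide_left_mono) auto
    finally show ?thesis by (simp add: G_def q_def)
  qed
  have bound: "integrable lborel G \<and> (LINT x|lborel. G x) \<le> 1 \<and>
      (\<forall>x. cmod (squared_kernel p z (Complex x v)) powr p \<le> G x)" if "0 < v" for v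
    using G pw[OF that] by (auto simp: has_bochner_integral_iff)
  show "squared_kernel p z \<in> Hp p" "Hp_norm p (squared_kernel p z) \<le> 1"
    using Hp_memI[of "squared_kernel p z" p "\<lambda>_. G" 1, OF holo _ bound] p by auto
qed

text \<open>
  With \<open>y = Im z\<close> and \<open>q = \<psi> z - cnj z\<close>, point evaluation of the difference gives
  \<open>\<bar>(y / q)\<^sup>2 + 1/4\<bar> \<le> 6 * (1/192) * pi\<^bsup>1/p\<^esup>\<close>, where \<open>-1/4\<close> is the value of \<open>(y / q)\<^sup>2\<close> at
  \<open>\<psi> z = z\<close>. As \<open>pi < 4\<close>, the right side is at most \<open>1/8\<close>, which keeps \<open>y / q\<close> away from \<open>0\<close>,
  that is, \<open>q\<close> within a multiple of \<open>y\<close>.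
\<close>

lemma displacement_le_Im:
  assumes p: "1 \<le> p" and z: "z \<in> upper_half_plane" and a: "\<psi> z \<in> upper_half_plane"
    and mem: "(\<lambda>w. squared_kernel p z (\<psi> w) - squared_kernel p z w) \<in> Hp p"
    and le: "Hp_norm p (\<lambda>w. squared_kernel p z (\<psi> w) - squared_kernel p z w) \<le> 1/192"
  shows "cmod (\<psi> z - z) \<le> 5 * Im z"
proof -
  define y where "y = Im z"
  have y: "0 < y" using z by (simp add: y_def upper_half_plane_def)
  define c where "c = y powr (2 - 1/p) / pi powr (1/p)"
  have c: "0 < c" using y by (simp add: c_def)
  define q where "q = \<psi> z - cnj z"
  have q: "q \<noteq> 0"
    using a y by (auto simp: q_def y_def upper_half_plane_def complex_eq_iff)
  have zz: "z - cnj z = 2 * \<i> * of_real y"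
    by (simp add: complex_eq_iff y_def)
  have "cmod (squared_kernel p z (\<psi> z) - squared_kernel p z z) \<le> 6 * (1/192) * y powr (-1/p)"
    unfolding y_def
  proof (rule point_evaluation_bound[OF p, where f = "\<lambda>w. squared_kernel p z (\<psi> w) - squared_kernel p z w"])
    show "(LINT x|lborel. cmod (squared_kernel p z (\<psi> (Complex x v)) - squared_kernel p z (Complex x v)) powr p)
        \<le> (1/192) powr p" if "0 < v" for v
      using Hp_line_mass_le[OF mem _ le that] p by simp
  qed (use mem z in \<open>auto simp: Hp_def\<close>)
  also have "squared_kernel p z (\<psi> z) - squared_kernel p z z
      = of_real (c / y\<^sup>2) * ((of_real y / q)\<^sup>2 + 1/4)"
    using y q by (simp add: squared_kernel_def zz flip: c_def y_def q_def)
      (simp add: field_simps power2_eq_square)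
  also have "cmod \<dots> = c / y\<^sup>2 * cmod ((of_real y / q)\<^sup>2 + 1/4)"
    using c by (simp add: norm_mult norm_divide norm_power del: of_real_divide)
  also have "c / y\<^sup>2 = y powr (-1/p) / pi powr (1/p)"
    using y by (simp add: c_def powr_diff powr_minus_divide)
  finally have "cmod ((of_real y / q)\<^sup>2 + 1/4) \<le> 6 * (1/192) * pi powr (1/p)"
    using y by (simp add: field_simps)
  moreover have "pi powr (1/p) \<le> pi powr 1"
    using p pi_ge_two by (intro powr_mono) auto
  ultimately have small: "cmod ((of_real y / q)\<^sup>2 + 1/4) \<le> 1/8"
    using pi_less_4 by simp
  have "1/4 \<le> cmod ((of_real y / q)\<^sup>2 + 1/4) + cmod ((of_real y / q)\<^sup>2)"
    using norm_triangle_ineq4[of "(of_real y / q)\<^sup>2 + 1/4" "(of_real y / q)\<^sup>2"] by simp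
  with small have "1/8 \<le> (y / cmod q)\<^sup>2"
    using y by (simp add: norm_power norm_divide)
  then have "(cmod q)\<^sup>2 \<le> 8 * y\<^sup>2"
    using q by (simp add: field_simps)
  also have "\<dots> \<le> (3 * y)\<^sup>2"
    by (simp add: power_mult_distrib)
  finally have "cmod q \<le> 3 * y"
    by (rule power2_le_imp_le) (use y in simp)
  moreover have "\<psi> z - z = q - 2 * \<i> * of_real y"
    using zz by (simp add: q_def algebra_simps)
  moreover have "cmod (q - 2 * \<i> * of_real y) \<le> cmod q + cmod (2 * \<i> * of_real y)"
    by (rule norm_triangle_ineq4)
  ultimately show ?thesis
    using y by (simp add: norm_mult y_def)
qed

section \<open>Composition operators close to the identity\<close>

text \<open>
  The displacement bound holds with the same constant at every point, so \<open>\<psi> z - z\<close> vanishes at the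
  real axis. Boundedness of the composition operator makes the operator norm of the difference the
  supremum of a bounded set, so that it does control the difference on each test function.
\<close>

lemma id_if_opnorm_small:
  assumes p: "1 \<le> p"
    and holo: "\<psi> holomorphic_on upper_half_plane"
    and self: "\<psi> ` upper_half_plane \<subseteq> upper_half_plane"
    and bounded: "bounded_on_Hp p (composition_operator \<psi>)"
    and small: "Hp_opnorm p (\<lambda>f z. composition_operator \<psi> f z - f z) \<le> 1/192"
    and z: "z \<in> upper_half_plane"
  shows "\<psi> z = z"
proof -
  let ?D = "\<lambda>f z. composition_operator \<psi> f z - f z"
  let ?B = "{f \<in> Hp p. Hp_norm p f \<le> 1}"
  obtain C where C: "\<And>f. f \<in> Hp p \<Longrightarrow> composition_operator \<psi> f \<in> Hp p"
    "\<And>f. f \<in> Hp p \<Longrightarrow> Hp_norm p (composition_operator \<psi> f) \<le> C * Hp_norm p f"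
    using bounded unfolding bounded_on_Hp_def by blast
  have D: "?D f \<in> Hp p \<and> Hp_norm p (?D f) \<le> (2 powr p * (\<bar>C\<bar> powr p + 1 powr p)) powr (1/p)"
    if f: "f \<in> ?B" for f
  proof -
    have "0 \<le> Hp_mean p f 1" by (simp add: Hp_mean_def)
    also have "\<dots> \<le> Hp_norm p f"
      unfolding Hp_norm_def using f by (intro cSUP_upper) (auto simp: Hp_def)
    finally have "C * Hp_norm p f \<le> \<bar>C\<bar> * 1"
      using f by (intro mult_mono) auto
    with C(2)[of f] f have "Hp_norm p (composition_operator \<psi> f) \<le> \<bar>C\<bar>"
      by simp
    with C(1)[of f] f p show ?thesis
      using Hp_diff[of "composition_operator \<psi> f" p f "\<bar>C\<bar>" 1] by auto
  qed
  have bdd: "bdd_above ((\<lambda>f. Hp_norm p (?D f)) ` ?B)"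
    using D by (auto simp: bdd_above_def)
  have le: "Hp_norm p (?D f) \<le> 1/192" if "f \<in> ?B" for f
    using small cSUP_upper[OF that bdd] unfolding Hp_opnorm_def by linarith
  have "\<psi> z - z = 0"
  proof (rule eq_0_if_norm_le_Im[OF _ _ z])
    show "(\<lambda>z. \<psi> z - z) holomorphic_on upper_half_plane"
      using holo by (intro holomorphic_intros)
    fix w assume w: "w \<in> upper_half_plane"
    have "squared_kernel p w \<in> ?B"
      using squared_kernel_in_unit_ball[OF p w] by simp
    then show "cmod (\<psi> w - w) \<le> 5 * Im w"
      using D[of "squared_kernel p w"] le[of "squared_kernel p w"] self w
      by (intro displacement_le_Im[OF p w]) (auto simp: composition_operator_def)
  qed
  then show ?thesis by simp
qed

lemma Hp_zero: "(\<lambda>_. 0) \<in> Hp p" "Hp_norm p (\<lambda>_. 0) = 0"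
  by (auto simp: Hp_def Hp_norm_def Hp_mean_def image_constant_conv)

lemma Hp_opnorm_eq_0_if_id:
  assumes "\<And>z. z \<in> upper_half_plane \<Longrightarrow> \<psi> z = z"
  shows "Hp_opnorm p (\<lambda>f z. composition_operator \<psi> f z - f z) = 0"
proof -
  have "Hp_norm p (\<lambda>z. composition_operator \<psi> f z - f z) = 0" for f
    using assms by (simp add: Hp_norm_def Hp_mean_def composition_operator_def upper_half_plane_def)
  then have "Hp_opnorm p (\<lambda>f z. composition_operator \<psi> f z - f z)
      = (SUP f\<in>{f \<in> Hp p. Hp_norm p f \<le> 1}. 0)"
    unfolding Hp_opnorm_def by simp
  also have "\<dots> = 0"
    using Hp_zero by (intro cSUP_const) force
  finally show ?thesis .
qed

lemma semigroup_id_if_id_near_0: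
  assumes sg: "analytic_semigroup \<phi>" and \<delta>: "0 < \<delta>"
    and id: "\<And>t z. 0 < t \<Longrightarrow> t < \<delta> \<Longrightarrow> z \<in> upper_half_plane \<Longrightarrow> \<phi> t z = z"
    and t: "0 \<le> t" and z: "z \<in> upper_half_plane"
  shows "\<phi> t z = z"
proof -
  have id': "\<phi> s z = z" if "0 \<le> s" "s < \<delta>" for s
    using id[of s z] sg z that by (cases "s = 0") (auto simp: analytic_semigroup_def)
  have mult: "\<phi> (of_nat n * s) z = z" if s: "0 \<le> s" "s < \<delta>" for s n
  proof (induction n)
    case 0
    then show ?case using id' \<delta> by simp
  next
    case (Suc n)
    have "\<phi> (of_nat n * s + s) z = \<phi> (of_nat n * s) (\<phi> s z)"
      using sg z s by (simp add: analytic_semigroup_def)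
    with Suc id'[OF s] show ?case by (simp add: algebra_simps)
  qed
  obtain n where n: "t / \<delta> < of_nat n"
    using reals_Archimedean2 by blast
  with t \<delta> have "0 < n"
    by (metis divide_nonneg_pos gr0I less_le_not_le of_nat_0)
  with n \<delta> have "t / of_nat n < \<delta>"
    by (simp add: field_simps)
  with mult[of "t / of_nat n" n] t \<open>0 < n\<close> show ?thesis by simp
qed

theorem corollary3p4:
  fixes p :: real and \<phi> :: "real \<Rightarrow> complex \<Rightarrow> complex"
  assumes "1 \<le> p"
    and "analytic_semigroup \<phi>"
    and "\<And>t. 0 \<le> t \<Longrightarrow> bounded_on_Hp p (composition_operator (\<phi> t))"
  shows "uniformly_continuous_semigroup_on_Hp p (\<lambda>t. composition_operator (\<phi> t)) \<longleftrightarrow>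
    (\<forall>t\<ge>0. \<forall>z\<in>upper_half_plane. \<phi> t z = z)"
proof
  assume "\<forall>t\<ge>0. \<forall>z\<in>upper_half_plane. \<phi> t z = z"
  then have "Hp_opnorm p (\<lambda>f z. composition_operator (\<phi> t) f z - f z) = 0" if "0 < t" for t
    using that by (intro Hp_opnorm_eq_0_if_id) auto
  then have "\<forall>\<^sub>F t in at_right 0. Hp_opnorm p (\<lambda>f z. composition_operator (\<phi> t) f z - f z) = 0"
    by (intro eventually_at_right_less[THEN eventually_mono])
  then show "uniformly_continuous_semigroup_on_Hp p (\<lambda>t. composition_operator (\<phi> t))"
    unfolding uniformly_continuous_semigroup_on_Hp_def by (rule tendsto_eventually)
next
  assume "uniformly_continuous_semigroup_on_Hp p (\<lambda>t. composition_operator (\<phi> t))"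
  then have "\<forall>\<^sub>F t in at_right 0. Hp_opnorm p (\<lambda>f z. composition_operator (\<phi> t) f z - f z) < 1/192"
    unfolding uniformly_continuous_semigroup_on_Hp_def by (rule order_tendstoD) simp
  then obtain \<delta> where \<delta>: "0 < \<delta>" "\<And>t. 0 < t \<Longrightarrow> t < \<delta> \<Longrightarrow>
      Hp_opnorm p (\<lambda>f z. composition_operator (\<phi> t) f z - f z) < 1/192"
    unfolding eventually_at_right_field by blast
  have "\<phi> t z = z" if "0 < t" "t < \<delta>" "z \<in> upper_half_plane" for t z
  proof (rule id_if_opnorm_small[OF assms(1)])
    show "\<phi> t holomorphic_on upper_half_plane" "\<phi> t ` upper_half_plane \<subseteq> upper_half_plane"
      using assms(2) that(1) by (simp_all add: analytic_semigroup_def)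
    show "bounded_on_Hp p (composition_operator (\<phi> t))"
      using assms(3) that(1) by simp
  qed (use \<delta>(2)[of t] that in auto)
  then show "\<forall>t\<ge>0. \<forall>z\<in>upper_half_plane. \<phi> t z = z"
    using semigroup_id_if_id_near_0[OF assms(2) \<delta>(1)] by blast
qed

end
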